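(* Let $l,m\geq 1$ and $n\geq 3$ be integers. <br> (1) $\Gamma_{\gcd(l,m)}(n)/\Gamma_m(n)$ is isomorphic to $\Gamma_l(n)/\Gamma_{\mathrm{lcm}(l,m)}(n)$. <br> (2) $\Gamma_{\gcd(l,m)}(n)/\Gamma_{\mathrm{lcm}(l,m)}(n)$ is isomorphic to each of the groups $$\Gamma_{\gcd(l,m)}(n)/\Gamma_l(n)\times\Gamma_{\gcd(l,m)}(n)/\Gamma_m(n)\quad\text{and}\quad \Gamma_l(n)/\Gamma_{\mathrm{lcm}(l,m)}(n)\times\Gamma_m(n)/\Gamma_{\mathrm{lcm}(l,m)}(n).$$ (3) If $l\mid m$ and $m\mid l^2$, then $\Gamma_l(n)/\Gamma_m(n)$ is isomorphic to $\left(\mathbb{Z}/\tfrac{m}{l}\mathbb{Z}\right)^{n^2-1}$.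
   Context: For integers $n\geq 1$ and $d\geq 2$, $\Gamma_d(n)=\{X\in \mathrm{SL}(n;\mathbb{Z}) \mid X\equiv I \pmod d\}$ is the level $d$ principal congruence subgroup of $\mathrm{SL}(n;\mathbb{Z})$; and $\Gamma_1(n)=\mathrm{SL}(n;\mathbb{Z})$. *)

theory Defs
  imports
    "Jordan_Normal_Form.Determinant"
    "HOL-Number_Theory.Cong"
    "HOL-Algebra.Coset"
    "HOL-Algebra.Elementary_Groups"
    "HOL-Algebra.Product_Groups"
begin

definition SL_int :: "nat \<Rightarrow> int mat monoid" where
  "SL_int n = \<lparr>carrier = {X \<in> carrier_mat n n. det X = 1}, monoid.mult = (*), one = 1\<^sub>m n\<rparr>"

text \<open>The congruence X = I (mod d) is entrywise.  For d = 1 it is vacuous, so that the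
  convention for level 1 (the whole of SL(n;Z)) needs no separate case.\<close>

definition congr_Gamma :: "nat \<Rightarrow> nat \<Rightarrow> int mat set" where
  "congr_Gamma d n = {X \<in> carrier (SL_int n).
     \<forall>i<n. \<forall>j<n. [X $$ (i, j) = 1\<^sub>m n $$ (i, j)] (mod int d)}"

lemma congr_Gamma_1: "congr_Gamma 1 n = carrier (SL_int n)"
  by (simp add: congr_Gamma_def)

text \<open>The quotient of \<open>congr_Gamma a n\<close> by \<open>congr_Gamma b n\<close>; meaningful when a divides b, so that
  \<open>congr_Gamma b n\<close> is a (normal) subgroup of \<open>congr_Gamma a n\<close>.\<close>

definition congr_quot :: "nat \<Rightarrow> nat \<Rightarrow> nat \<Rightarrow> int mat set monoid" where
  "congr_quot n a b = (SL_int n)\<lparr>carrier := congr_Gamma a n\<rparr> Mod congr_Gamma b n"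

definition Zmod_power :: "nat \<Rightarrow> nat \<Rightarrow> (nat \<Rightarrow> int) monoid" where
  "Zmod_power q k = product_group {..<k} (\<lambda>_. integer_mod_group q)"

end

theory Submission
  imports Defs "HOL-Algebra.SndIsomorphismGrp"
begin

text \<open>Write \<open>\<Gamma>\<^sub>d\<close> for the principal congruence subgroup of level d in \<open>SL(n; \<int>)\<close>. The arithmetic input is
  that reduction modulo d maps \<open>SL(n; \<int>)\<close> onto \<open>SL(n; \<int>/d)\<close>, that is, every integral matrix of
  determinant 1 mod d is congruent to one of determinant 1 (\<open>SL_liftable_if_det_cong_1\<close>). It is
  proved by row reduction of the first column and induction on n.

  With the Chinese remainder theorem, lifting shows that \<open>\<Gamma>\<^sub>l \<Gamma>\<^sub>m\<close> is the congruence subgroup of level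
  \<open>gcd l m\<close> (\<open>congr_Gamma_set_mult\<close>), while \<open>\<Gamma>\<^sub>l \<inter> \<Gamma>\<^sub>m\<close> is visibly the one of level \<open>lcm l m\<close>.
  The first isomorphism is then the second isomorphism theorem. The first product decomposition
  is the fact that \<open>G/(N1 \<inter> N2)\<close> is the product of \<open>G/N1\<close> and \<open>G/N2\<close> when \<open>N1 N2 = G\<close>, and the second
  one follows from it by applying the first isomorphism to both factors, which swaps them.

  For \<open>l dvd m\<close> and \<open>m dvd l\<^sup>2\<close> put \<open>q = m div l\<close>, which divides l. The map \<open>1 + l A \<mapsto> A mod q\<close> is a
  homomorphism from \<open>\<Gamma>\<^sub>l\<close> to additive matrices, with kernel \<open>\<Gamma>\<^sub>m\<close>. Since
  \<open>det (1 + l A) = 1 + l tr A\<close> modulo \<open>l\<^sup>2\<close>, its values have trace zero mod q, and by lifting all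
  matrices of trace zero mod q occur. Dropping the last diagonal entry identifies these with
  \<open>n\<^sup>2 - 1\<close> free residues mod q.\<close>

section \<open>Congruence of integer matrices\<close>

definition mat_cong :: "nat \<Rightarrow> int \<Rightarrow> int mat \<Rightarrow> int mat \<Rightarrow> bool" where
  "mat_cong n d A B \<longleftrightarrow> (\<forall>i<n. \<forall>j<n. [A $$ (i, j) = B $$ (i, j)] (mod d))"

lemma mat_congD: "mat_cong n d A B \<Longrightarrow> i < n \<Longrightarrow> j < n \<Longrightarrow> [A $$ (i, j) = B $$ (i, j)] (mod d)"
  by (simp add: mat_cong_def)

lemma mat_cong_refl [simp]: "mat_cong n d A A"
  by (simp add: mat_cong_def)

lemma mat_cong_sym: "mat_cong n d A B \<Longrightarrow> mat_cong n d B A"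
  by (simp add: mat_cong_def cong_sym)

lemma mat_cong_trans [trans]: "mat_cong n d A B \<Longrightarrow> mat_cong n d B C \<Longrightarrow> mat_cong n d A C"
  unfolding mat_cong_def by (blast intro: cong_trans)

lemma mat_cong_dvd_modulus: "mat_cong n d A B \<Longrightarrow> e dvd d \<Longrightarrow> mat_cong n e A B"
  by (auto simp: mat_cong_def intro: cong_dvd_modulus)

lemma mat_cong_lcm_iff: "mat_cong n (lcm l m) A B \<longleftrightarrow> mat_cong n l A B \<and> mat_cong n m A B"
  by (auto simp: mat_cong_def cong_iff_dvd_diff)

lemma mat_cong_mult:
  assumes "A \<in> carrier_mat n n" "A' \<in> carrier_mat n n" "B \<in> carrier_mat n n" "B' \<in> carrier_mat n n"
    and "mat_cong n d A A'" "mat_cong n d B B'"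
  shows "mat_cong n d (A * B) (A' * B')"
  using assms by (auto simp: mat_cong_def scalar_prod_def intro!: cong_sum cong_mult)

lemma mat_cong_det:
  assumes A: "A \<in> carrier_mat n n" and B: "B \<in> carrier_mat n n" and "mat_cong n d A B"
  shows "[det A = det B] (mod d)"
proof -
  have "[\<Prod>i = 0..<n. A $$ (i, p i) = \<Prod>i = 0..<n. B $$ (i, p i)] (mod d)"
    if "p permutes {0..<n}" for p
    using that assms permutes_in_image[OF that] by (auto simp: mat_cong_def intro!: cong_prod)
  then show ?thesis
    unfolding det_def'[OF A] det_def'[OF B] by (intro cong_sum cong_mult cong_refl) auto
qed

section \<open>Lifting matrices of determinant 1 from the integers mod d\<close>

definition SL_liftable :: "nat \<Rightarrow> int \<Rightarrow> int mat \<Rightarrow> bool" where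
  "SL_liftable n d M \<longleftrightarrow> (\<exists>X \<in> carrier_mat n n. det X = 1 \<and> mat_cong n d X M)"

text \<open>A row operation is undone on the lift by the opposite row operation, which keeps the
  determinant. So the matrix to be lifted may be simplified by integral row operations.\<close>

lemma SL_liftable_addrow:
  assumes M: "M \<in> carrier_mat n n" and kl: "k < n" "l < n" "k \<noteq> l"
    and "SL_liftable n d (addrow a k l M)"
  shows "SL_liftable n d M"
proof -
  obtain X where X: "X \<in> carrier_mat n n" "det X = 1" "mat_cong n d X (addrow a k l M)"
    using assms(5) by (auto simp: SL_liftable_def)
  let ?Y = "addrow (- a) k l X"
  have "[X $$ (k, j) - a * X $$ (l, j) = (a * M $$ (l, j) + M $$ (k, j)) - a * M $$ (l, j)] (mod d)"
    if "j < n" for j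
    using mat_congD[OF X(3) kl(1) that] mat_congD[OF X(3) kl(2) that] M kl that
    by (intro cong_diff cong_mult cong_refl) auto
  moreover have "[X $$ (i, j) = M $$ (i, j)] (mod d)" if "i < n" "j < n" "i \<noteq> k" for i j
    using mat_congD[OF X(3) that(1,2)] M kl that by auto
  ultimately have "mat_cong n d ?Y M"
    using X(1) kl unfolding mat_cong_def by (auto simp: algebra_simps)
  moreover have "det ?Y = 1"
    using det_addrow[of l n k X "- a"] X kl by simp
  ultimately show ?thesis
    using X(1) by (auto simp: SL_liftable_def intro!: bexI[of _ ?Y])
qed

text \<open>Once the first column is the first unit vector mod d, only the lower right block has to be
  lifted: in a block triangular matrix with corner 1 the first row does not affect the
  determinant, so it may be copied unchanged.\<close>

lemma SL_liftable_block:
  assumes IH: "\<And>B. B \<in> carrier_mat k k \<Longrightarrow> [det B = 1] (mod d) \<Longrightarrow> SL_liftable k d B"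
    and M: "M \<in> carrier_mat (Suc k) (Suc k)" and det: "[det M = 1] (mod d)"
    and c0: "[M $$ (0, 0) = 1] (mod d)"
    and ci: "\<And>i. 0 < i \<Longrightarrow> i < Suc k \<Longrightarrow> [M $$ (i, 0) = 0] (mod d)"
  shows "SL_liftable (Suc k) d M"
proof -
  define B where "B = mat k k (\<lambda>(i, j). M $$ (Suc i, Suc j))"
  define bl where "bl Y = four_block_mat (1\<^sub>m 1) (mat 1 k (\<lambda>(i, j). M $$ (0, Suc j))) (0\<^sub>m k 1) Y"
    for Y :: "int mat"
  have bl_carr: "bl Y \<in> carrier_mat (Suc k) (Suc k)" if "Y \<in> carrier_mat k k" for Y
    using that four_block_carrier_mat[of "1\<^sub>m 1" 1 1 Y k k] by (simp add: bl_def)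
  have bl_det: "det (bl Y) = det Y" if "Y \<in> carrier_mat k k" for Y
    unfolding bl_def
    by (subst det_four_block_mat_lower_left_zero[where n = 1 and m = k]) (use that in auto)
  have bl_cong: "mat_cong (Suc k) d (bl Y) M" if Y: "Y \<in> carrier_mat k k" "mat_cong k d Y B" for Y
    unfolding mat_cong_def
  proof (intro allI impI)
    fix i j assume "i < Suc k" "j < Suc k"
    then show "[bl Y $$ (i, j) = M $$ (i, j)] (mod d)"
      using Y c0 ci mat_congD[OF Y(2), of "i - 1" "j - 1"]
      by (cases i; cases j) (auto simp: bl_def B_def cong_sym_eq)
  qed
  have B: "B \<in> carrier_mat k k" by (simp add: B_def)
  have "[det B = 1] (mod d)"
    using mat_cong_det[OF bl_carr[OF B] M bl_cong[OF B]] bl_det[OF B] det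
    by (auto intro: cong_trans)
  from IH[OF B this] obtain Y where "Y \<in> carrier_mat k k" "det Y = 1" "mat_cong k d Y B"
    by (auto simp: SL_liftable_def)
  then show ?thesis
    using bl_carr bl_det bl_cong by (auto simp: SL_liftable_def intro!: bexI[of _ "bl Y"])
qed

text \<open>Let h be the only entry below the corner that may be nonzero, a unit mod d. Adding a multiple of
  its row turns the corner c into \<open>c + (1 - c) x h\<close>, which is 1 mod d when x inverts h. The corner
  then clears h, and the column is a unit vector mod d.\<close>

lemma SL_liftable_single_entry_column:
  assumes IH: "\<And>B. B \<in> carrier_mat k k \<Longrightarrow> [det B = 1] (mod d) \<Longrightarrow> SL_liftable k d B"
    and M: "M \<in> carrier_mat (Suc k) (Suc k)" and det: "[det M = 1] (mod d)"
    and p: "0 < p" "p < Suc k" and z: "\<And>i. i < Suc k \<Longrightarrow> i \<noteq> 0 \<Longrightarrow> i \<noteq> p \<Longrightarrow> M $$ (i, 0) = 0"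
    and x: "[x * M $$ (p, 0) = 1] (mod d)"
  shows "SL_liftable (Suc k) d M"
proof -
  let ?h = "M $$ (p, 0)" and ?c = "M $$ (0, 0)"
  define M1 where "M1 = addrow ((1 - ?c) * x) 0 p M"
  define M2 where "M2 = addrow (- ?h) p 0 M1"
  have M1: "M1 \<in> carrier_mat (Suc k) (Suc k)" and M2: "M2 \<in> carrier_mat (Suc k) (Suc k)"
    using M by (auto simp: M1_def M2_def)
  have "det M2 = det M"
    using det_addrow[of p "Suc k" 0 M] det_addrow[of 0 "Suc k" p M1] M M1 p
    by (simp add: M1_def M2_def)
  moreover
  have e0: "M1 $$ (0, 0) = (1 - ?c) * (x * ?h) + ?c" and ep: "M1 $$ (p, 0) = ?h"
    using M p by (auto simp: M1_def)
  have c1: "[M1 $$ (0, 0) = 1] (mod d)"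
    using cong_add[OF cong_mult[OF cong_refl[of "1 - ?c"] x] cong_refl[of ?c]] unfolding e0 by simp
  have "M2 $$ (0, 0) = M1 $$ (0, 0)"
    using M1 p by (auto simp: M2_def)
  moreover have "[M2 $$ (i, 0) = 0] (mod d)" if "0 < i" "i < Suc k" for i
  proof (cases "i = p")
    case True
    have "M2 $$ (p, 0) = - ?h * M1 $$ (0, 0) + ?h"
      using M1 p ep by (auto simp: M2_def)
    moreover have "[- ?h * M1 $$ (0, 0) + ?h = - ?h * 1 + ?h] (mod d)"
      by (intro cong_add cong_mult cong_refl c1)
    ultimately show ?thesis using True by simp
  next
    case False
    then have "M2 $$ (i, 0) = M $$ (i, 0)"
      using M M1 that by (auto simp: M2_def M1_def)
    then show ?thesis using z that False by simp
  qed
  ultimately have "SL_liftable (Suc k) d M2"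
    using c1 det by (intro SL_liftable_block[OF IH M2]) auto
  then have "SL_liftable (Suc k) d M1"
    unfolding M2_def using p by (intro SL_liftable_addrow[OF M1]) auto
  then show ?thesis
    unfolding M1_def using p by (intro SL_liftable_addrow[OF M]) auto
qed

text \<open>This is the surjectivity of the reduction from \<open>SL(n; \<int>)\<close> to \<open>SL(n; \<int>/d)\<close>. The Euclidean
  algorithm on the first column leaves at most one nonzero entry; expanding the determinant along
  that column shows that the remaining entry is a unit mod d, with its cofactor as inverse. The column can
  then be made a unit vector mod d, and induction on the size lifts the remaining block. The
  inner induction is on the sum of the absolute values in the first column.\<close>

theorem SL_liftable_if_det_cong_1:
  assumes "M \<in> carrier_mat n n" "[det M = 1] (mod d)"
  shows "SL_liftable n d M"
  using assms
proof (induction n arbitrary: M)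
  case 0
  then show ?case by (auto simp: SL_liftable_def intro!: bexI[of _ M])
next
  case (Suc k)
  note IH = Suc.IH
  show ?case
  proof (cases "k = 0")
    case True
    with Suc.prems have "det M = M $$ (0, 0)"
      by (simp add: det_single)
    then show ?thesis
      using Suc.prems True by (intro SL_liftable_block[OF IH]) auto
  next
    case False
    show ?thesis
      using Suc.prems
    proof (induction "\<Sum>i<Suc k. nat \<bar>M $$ (i, 0)\<bar>" arbitrary: M rule: less_induct)
      case less
      note M = less.prems(1) and det = less.prems(2)
      show ?case
      proof (cases "\<exists>i<Suc k. \<exists>j<Suc k. i \<noteq> j \<and> M $$ (j, 0) \<noteq> 0 \<and> \<bar>M $$ (j, 0)\<bar> \<le> \<bar>M $$ (i, 0)\<bar>")
        case True
        then obtain i j where ij: "i < Suc k" "j < Suc k" "i \<noteq> j" "M $$ (j, 0) \<noteq> 0"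
          "\<bar>M $$ (j, 0)\<bar> \<le> \<bar>M $$ (i, 0)\<bar>" by blast
        define M' where "M' = addrow (- (M $$ (i, 0) div M $$ (j, 0))) i j M"
        have M': "M' \<in> carrier_mat (Suc k) (Suc k)" using M by (simp add: M'_def)
        have "M' $$ (i, 0) = M $$ (i, 0) mod M $$ (j, 0)"
          using M ij by (auto simp: M'_def minus_div_mult_eq_mod[symmetric])
        then have "\<bar>M' $$ (i, 0)\<bar> < \<bar>M $$ (i, 0)\<bar>"
          using abs_mod_less[OF ij(4), of "M $$ (i, 0)"] ij(5) by simp
        moreover have "M' $$ (r, 0) = M $$ (r, 0)" if "r < Suc k" "r \<noteq> i" for r
          using M that by (auto simp: M'_def)
        ultimately have "(\<Sum>r<Suc k. nat \<bar>M' $$ (r, 0)\<bar>) < (\<Sum>r<Suc k. nat \<bar>M $$ (r, 0)\<bar>)"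
          using ij(1) by (intro sum_strict_mono_ex1) (force intro!: bexI[of _ i])+
        moreover have "det M' = det M"
          using det_addrow[OF ij(2,3) M] by (simp add: M'_def)
        ultimately have "SL_liftable (Suc k) d M'"
          using less.hyps[of M'] M' det by simp
        then show ?thesis
          unfolding M'_def by (rule SL_liftable_addrow[OF M ij(1,2,3)])
      next
        case False
        \<comment> \<open>Two nonzero entries could be compared, so at most one is left.\<close>
        obtain p where p: "p < Suc k" "\<And>i. i < Suc k \<Longrightarrow> i \<noteq> p \<Longrightarrow> M $$ (i, 0) = 0"
        proof (cases "\<exists>p<Suc k. M $$ (p, 0) \<noteq> 0")
          case True
          then obtain p where "p < Suc k" "M $$ (p, 0) \<noteq> 0" by blast
          with False that[of p] show ?thesis by (metis linear)
        qed (use that[of 0] in auto)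
        let ?h = "M $$ (p, 0)"
        have "det M = (\<Sum>i<Suc k. M $$ (i, 0) * cofactor M i 0)"
          by (rule laplace_expansion_column[OF M]) simp
        also have "\<dots> = (\<Sum>i\<in>{p}. M $$ (i, 0) * cofactor M i 0)"
          using p by (intro sum.mono_neutral_right) auto
        finally have x: "[cofactor M p 0 * ?h = 1] (mod d)"
          using det by (simp add: mult.commute)
        show ?thesis
        proof (cases "p = 0")
          case pos: False
          then show ?thesis
            using p x by (intro SL_liftable_single_entry_column[OF IH M det, where p = p]) auto
        next
          case True
          \<comment> \<open>The unit sits in the corner: copy it one row down.\<close>
          define M' where "M' = addrow 1 1 0 M"
          have M': "M' \<in> carrier_mat (Suc k) (Suc k)" using M by (simp add: M'_def)
          have "det M' = det M"
            using det_addrow[of 0 "Suc k" 1 M 1] M \<open>k \<noteq> 0\<close> by (simp add: M'_def)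
          moreover have "M' $$ (1, 0) = ?h" "\<And>i. i < Suc k \<Longrightarrow> i \<noteq> 0 \<Longrightarrow> i \<noteq> 1 \<Longrightarrow> M' $$ (i, 0) = 0"
            using M p True \<open>k \<noteq> 0\<close> by (auto simp: M'_def)
          ultimately have "SL_liftable (Suc k) d M'"
            using x det \<open>k \<noteq> 0\<close>
            by (intro SL_liftable_single_entry_column[OF IH M', where p = 1]) auto
          then show ?thesis
            unfolding M'_def using \<open>k \<noteq> 0\<close> by (intro SL_liftable_addrow[OF M]) auto
        qed
      qed
    qed
  qed
qed

section \<open>Quotients by two normal subgroups that generate the group\<close>

text \<open>The kernel of \<open>g \<mapsto> (N1 g, N2 g)\<close> is the intersection. The map is onto because any
  \<open>x y\<inverse>\<close> is a product \<open>a b\<close> with a in N1 and b in N2.\<close>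

lemma normal_quotient_Int_iso_DirProd:
  assumes "N1 \<lhd> G" "N2 \<lhd> G" and gen: "N1 <#>\<^bsub>G\<^esub> N2 = carrier G"
  shows "G Mod (N1 \<inter> N2) \<cong> (G Mod N1) \<times>\<times> (G Mod N2)"
proof -
  interpret N1: normal N1 G by fact
  interpret N2: normal N2 G by fact
  let ?h = "\<lambda>g. (N1 #>\<^bsub>G\<^esub> g, N2 #>\<^bsub>G\<^esub> g)" and ?P = "(G Mod N1) \<times>\<times> (G Mod N2)"
  have "group ?P"
    by (intro DirProd_group N1.factorgroup_is_group N2.factorgroup_is_group)
  moreover have "?h \<in> hom G ?P"
    using N1.r_coset_hom_Mod N2.r_coset_hom_Mod by (simp add: hom_paired)
  ultimately interpret h: group_hom G ?P ?h
    by (simp add: group_hom_def group_hom_axioms_def)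
  have ker: "kernel G ?P ?h = N1 \<inter> N2"
  proof -
    have "N #>\<^bsub>G\<^esub> g = N \<longleftrightarrow> g \<in> N" if "subgroup N G" "g \<in> carrier G" for N g
      using that N1.coset_join1 N1.coset_join2 by blast
    then have "kernel G ?P ?h = {g \<in> carrier G. g \<in> N1 \<and> g \<in> N2}"
      using N1.is_subgroup N2.is_subgroup by (auto simp: kernel_def FactGroup_def cong: conj_cong)
    then show ?thesis using N1.subset by blast
  qed
  have "?h ` carrier G = carrier ?P"
  proof
    show "?h ` carrier G \<subseteq> carrier ?P"
      using h.hom_closed by blast
    show "carrier ?P \<subseteq> ?h ` carrier G"
    proof
      fix c assume "c \<in> carrier ?P"
      then obtain x y where xy: "x \<in> carrier G" "y \<in> carrier G" "c = (N1 #>\<^bsub>G\<^esub> x, N2 #>\<^bsub>G\<^esub> y)"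
        by (auto simp: FactGroup_def RCOSETS_def)
      then have "x \<otimes>\<^bsub>G\<^esub> inv\<^bsub>G\<^esub> y \<in> N1 <#>\<^bsub>G\<^esub> N2"
        by (simp add: gen)
      then obtain a b where ab: "a \<in> N1" "b \<in> N2" "x \<otimes>\<^bsub>G\<^esub> inv\<^bsub>G\<^esub> y = a \<otimes>\<^bsub>G\<^esub> b"
        by (auto simp: set_mult_def)
      have ab_carr: "a \<in> carrier G" "b \<in> carrier G"
        using ab N1.subset N2.subset by auto
      \<comment> \<open>\<open>z = a\<inverse> x = b y\<close> represents both cosets.\<close>
      define z where "z = b \<otimes>\<^bsub>G\<^esub> y"
      have "x = a \<otimes>\<^bsub>G\<^esub> z"
        using ab(3) ab_carr xy unfolding z_def
        by (metis N1.inv_solve_right N1.m_assoc N1.m_closed)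
      then have "x \<in> N1 #>\<^bsub>G\<^esub> z" "z \<in> N2 #>\<^bsub>G\<^esub> y"
        using ab by (auto simp: r_coset_def z_def)
      moreover have z: "z \<in> carrier G"
        using ab_carr xy by (simp add: z_def)
      ultimately have "c = ?h z"
        using xy N1.repr_independence N1.is_subgroup N2.is_subgroup by metis
      with z show "c \<in> ?h ` carrier G" by blast
    qed
  qed
  from h.FactGroup_iso[OF this] show ?thesis by (simp add: ker)
qed

section \<open>Principal congruence subgroups\<close>

lemma SL_int_simps [simp]:
  "X \<in> carrier (SL_int n) \<longleftrightarrow> X \<in> carrier_mat n n \<and> det X = 1"
  "mult (SL_int n) = (*)" "one (SL_int n) = 1\<^sub>m n"
  by (auto simp: SL_int_def)

lemma group_SL_int: "group (SL_int n)"
proof (rule groupI)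
  fix X Y Z
  assume X: "X \<in> carrier (SL_int n)" and Y: "Y \<in> carrier (SL_int n)"
  then show "X \<otimes>\<^bsub>SL_int n\<^esub> Y \<in> carrier (SL_int n)" by (auto simp: det_mult[of X n Y])
  assume "Z \<in> carrier (SL_int n)"
  with X Y show "X \<otimes>\<^bsub>SL_int n\<^esub> Y \<otimes>\<^bsub>SL_int n\<^esub> Z = X \<otimes>\<^bsub>SL_int n\<^esub> (Y \<otimes>\<^bsub>SL_int n\<^esub> Z)"
    by (simp add: assoc_mult_mat[of _ n n _ n _ n])
next
  fix X
  assume X: "X \<in> carrier (SL_int n)"
  then show "\<one>\<^bsub>SL_int n\<^esub> \<otimes>\<^bsub>SL_int n\<^esub> X = X" by (simp add: left_mult_one_mat[of X n n])
  have adj: "adj_mat X \<in> carrier_mat n n" "adj_mat X * X = 1\<^sub>m n"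
    using X adj_mat[of X n] by auto
  then have "det (adj_mat X) = 1"
    using det_mult[of "adj_mat X" n X] X by simp
  with adj show "\<exists>Y \<in> carrier (SL_int n). Y \<otimes>\<^bsub>SL_int n\<^esub> X = \<one>\<^bsub>SL_int n\<^esub>" by auto
qed (simp)

lemma mem_congr_Gamma_iff:
  "X \<in> congr_Gamma d n \<longleftrightarrow> X \<in> carrier (SL_int n) \<and> mat_cong n (int d) X (1\<^sub>m n)"
  by (auto simp: congr_Gamma_def mat_cong_def)

lemma congr_Gamma_normal: "congr_Gamma d n \<lhd> SL_int n"
proof -
  interpret group "SL_int n" by (rule group_SL_int)
  \<comment> \<open>Modulo d a factor from the congruence subgroup may be dropped; with \<open>B = A\<inverse>\<close> this gives
    normality, and with \<open>A = 1\<close>, \<open>B = X\<inverse>\<close> closure under inverses.\<close>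
  have conj: "mat_cong n (int d) (A * X * B) (A * B)"
    if "A \<in> carrier_mat n n" "B \<in> carrier_mat n n" "X \<in> congr_Gamma d n" for A B X
    using that mat_cong_mult[of "A * X" n "A * 1\<^sub>m n" B B "int d"] mat_cong_mult[of A n A X "1\<^sub>m n" "int d"]
    by (auto simp: mem_congr_Gamma_iff)
  show ?thesis
  proof (rule normal_invI)
    show "subgroup (congr_Gamma d n) (SL_int n)"
    proof (rule subgroupI)
      show "congr_Gamma d n \<subseteq> carrier (SL_int n)" by (auto simp: mem_congr_Gamma_iff)
      have "1\<^sub>m n \<in> congr_Gamma d n" by (simp add: mem_congr_Gamma_iff)
      then show "congr_Gamma d n \<noteq> {}" by blast
    next
      fix X assume X: "X \<in> congr_Gamma d n"
      then have XG: "X \<in> carrier (SL_int n)" by (simp add: mem_congr_Gamma_iff)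
      have Y: "inv\<^bsub>SL_int n\<^esub> X \<in> carrier (SL_int n)" using XG by (rule inv_closed)
      have "X * inv\<^bsub>SL_int n\<^esub> X = 1\<^sub>m n" using r_inv[OF XG] by simp
      then have "mat_cong n (int d) (1\<^sub>m n) (inv\<^bsub>SL_int n\<^esub> X)"
        using conj[of "1\<^sub>m n" "inv\<^bsub>SL_int n\<^esub> X" X] X XG Y
          by (simp add: left_mult_one_mat[of X n n] left_mult_one_mat[of "inv\<^bsub>SL_int n\<^esub> X" n n])
      then show "inv\<^bsub>SL_int n\<^esub> X \<in> congr_Gamma d n"
        using Y by (simp add: mem_congr_Gamma_iff mat_cong_sym)
    next
      fix X Y assume XY: "X \<in> congr_Gamma d n" "Y \<in> congr_Gamma d n"
      then have "X \<otimes>\<^bsub>SL_int n\<^esub> Y \<in> carrier (SL_int n)"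
        by (intro m_closed) (simp_all add: mem_congr_Gamma_iff)
      moreover have "mat_cong n (int d) (X * Y) (1\<^sub>m n * 1\<^sub>m n)"
        using XY by (intro mat_cong_mult) (auto simp: mem_congr_Gamma_iff)
      ultimately show "X \<otimes>\<^bsub>SL_int n\<^esub> Y \<in> congr_Gamma d n"
        by (simp add: mem_congr_Gamma_iff)
    qed
  next
    fix A X assume A: "A \<in> carrier (SL_int n)" and X: "X \<in> congr_Gamma d n"
    have "A \<otimes>\<^bsub>SL_int n\<^esub> X \<otimes>\<^bsub>SL_int n\<^esub> inv\<^bsub>SL_int n\<^esub> A \<in> carrier (SL_int n)"
      using A X by (intro m_closed inv_closed) (simp_all add: mem_congr_Gamma_iff)
    moreover have "A * inv\<^bsub>SL_int n\<^esub> A = 1\<^sub>m n" using r_inv[OF A] by simp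
    then have "mat_cong n (int d) (A * X * inv\<^bsub>SL_int n\<^esub> A) (1\<^sub>m n)"
      using conj[of A "inv\<^bsub>SL_int n\<^esub> A" X] A X inv_closed[OF A] by simp
    ultimately show "A \<otimes>\<^bsub>SL_int n\<^esub> X \<otimes>\<^bsub>SL_int n\<^esub> inv\<^bsub>SL_int n\<^esub> A \<in> congr_Gamma d n"
      by (simp add: mem_congr_Gamma_iff)
  qed
qed

lemma congr_Gamma_subgroup: "subgroup (congr_Gamma d n) (SL_int n)"
  by (rule normal_imp_subgroup[OF congr_Gamma_normal])

lemma congr_Gamma_antimono: "d dvd e \<Longrightarrow> congr_Gamma e n \<subseteq> congr_Gamma d n"
  using mat_cong_dvd_modulus by (fastforce simp: mem_congr_Gamma_iff)

lemma congr_Gamma_normal_in: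
  "d dvd e \<Longrightarrow> congr_Gamma e n \<lhd> (SL_int n)\<lparr>carrier := congr_Gamma d n\<rparr>"
  by (intro group.normal_restrict_supergroup group_SL_int congr_Gamma_subgroup
        congr_Gamma_normal congr_Gamma_antimono)

lemma group_congr_quot: "a dvd b \<Longrightarrow> group (congr_quot n a b)"
  unfolding congr_quot_def by (intro normal.factorgroup_is_group congr_Gamma_normal_in)

lemma congr_Gamma_Int: "congr_Gamma l n \<inter> congr_Gamma m n = congr_Gamma (lcm l m) n"
  by (auto simp: mem_congr_Gamma_iff mat_cong_lcm_iff simp flip: lcm_int_int_eq)

text \<open>The Chinese remainder theorem for moduli that need not be coprime: the residues only have to
  agree modulo the gcd. The Bezout coefficients split the difference \<open>a - b\<close> into a multiple of l
  and a multiple of m.\<close>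

lemma chinese_remainder_gcd_int:
  fixes a b l m :: int
  assumes "[a = b] (mod gcd l m)"
  shows "\<exists>z. [z = a] (mod l) \<and> [z = b] (mod m)"
proof -
  obtain t where t: "a - b = gcd l m * t"
    using assms by (auto simp: cong_iff_dvd_diff)
  obtain u v where "u * l + v * m = gcd l m"
    using bezout_int by blast
  with t have eq: "a - u * l * t = b + v * m * t"
    by (simp add: algebra_simps flip: \<open>u * l + v * m = gcd l m\<close>)
  have "[a - u * l * t = a] (mod l)" by (simp add: cong_iff_dvd_diff)
  moreover have "[a - u * l * t = b] (mod m)" unfolding eq by (simp add: cong_iff_dvd_diff)
  ultimately show ?thesis by blast
qed

text \<open>The entrywise Chinese remainder theorem gives an integral matrix whose determinant is 1 modulo
  both l and m, hence modulo their lcm; lifting it modulo the lcm changes neither residue.\<close>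

lemma SL_int_chinese_remainder:
  assumes X: "X \<in> carrier_mat n n" "[det X = 1] (mod l)"
    and Y: "Y \<in> carrier_mat n n" "[det Y = 1] (mod m)"
    and "mat_cong n (gcd l m) X Y"
  shows "\<exists>Z \<in> carrier (SL_int n). mat_cong n l Z X \<and> mat_cong n m Z Y"
proof -
  have "\<forall>i j. \<exists>z. i < n \<longrightarrow> j < n \<longrightarrow> [z = X $$ (i, j)] (mod l) \<and> [z = Y $$ (i, j)] (mod m)"
    using assms(5) chinese_remainder_gcd_int unfolding mat_cong_def by blast
  then obtain z where z: "\<And>i j. i < n \<Longrightarrow> j < n \<Longrightarrow>
      [z i j = X $$ (i, j)] (mod l) \<and> [z i j = Y $$ (i, j)] (mod m)"
    by metis
  define M where "M = mat n n (\<lambda>(i, j). z i j)"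
  have M: "M \<in> carrier_mat n n" "mat_cong n l M X" "mat_cong n m M Y"
    using z by (auto simp: M_def mat_cong_def)
  have "[det M = 1] (mod l)" "[det M = 1] (mod m)"
    using mat_cong_det[OF M(1) X(1) M(2)] mat_cong_det[OF M(1) Y(1) M(3)] X(2) Y(2)
    by (auto intro: cong_trans)
  then have "[det M = 1] (mod lcm l m)" by (simp add: cong_iff_dvd_diff)
  then obtain Z where Z: "Z \<in> carrier_mat n n" "det Z = 1" "mat_cong n (lcm l m) Z M"
    using SL_liftable_if_det_cong_1[OF M(1)] by (auto simp: SL_liftable_def)
  have "mat_cong n l Z M" "mat_cong n m Z M"
    using Z(3) by (simp_all add: mat_cong_lcm_iff)
  with Z M show ?thesis by (auto intro!: bexI[of _ Z] intro: mat_cong_trans)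
qed

text \<open>For X of level \<open>gcd l m\<close>, the identity and X agree modulo the gcd, so some Y is the identity
  mod l and X mod m. Then \<open>X = Y (Y\<inverse> X)\<close> is the required factorization.\<close>

lemma congr_Gamma_set_mult:
  "congr_Gamma l n <#>\<^bsub>SL_int n\<^esub> congr_Gamma m n = congr_Gamma (gcd l m) n"
proof
  interpret group "SL_int n" by (rule group_SL_int)
  interpret \<Gamma>: subgroup "congr_Gamma (gcd l m) n" "SL_int n" by (rule congr_Gamma_subgroup)
  show "congr_Gamma l n <#>\<^bsub>SL_int n\<^esub> congr_Gamma m n \<subseteq> congr_Gamma (gcd l m) n"
    using congr_Gamma_antimono[of "gcd l m" l n] congr_Gamma_antimono[of "gcd l m" m n] \<Gamma>.m_closed
    unfolding set_mult_def by blast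
  show "congr_Gamma (gcd l m) n \<subseteq> congr_Gamma l n <#>\<^bsub>SL_int n\<^esub> congr_Gamma m n"
  proof
    fix X assume X: "X \<in> congr_Gamma (gcd l m) n"
    then have XG: "X \<in> carrier (SL_int n)" by (rule \<Gamma>.mem_carrier)
    have "mat_cong n (gcd (int l) (int m)) (1\<^sub>m n) X"
      using X by (simp add: mem_congr_Gamma_iff mat_cong_sym)
    then obtain Y where Y: "Y \<in> carrier (SL_int n)" "mat_cong n (int l) Y (1\<^sub>m n)" "mat_cong n (int m) Y X"
      using SL_int_chinese_remainder[of "1\<^sub>m n" n "int l" X "int m"] XG by auto
    define Z where "Z = inv\<^bsub>SL_int n\<^esub> Y \<otimes>\<^bsub>SL_int n\<^esub> X"
    have inv: "inv\<^bsub>SL_int n\<^esub> Y \<in> carrier (SL_int n)" using Y(1) by (rule inv_closed)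
    have "mat_cong n (int m) (inv\<^bsub>SL_int n\<^esub> Y * X) (inv\<^bsub>SL_int n\<^esub> Y * Y)"
      using inv XG Y by (intro mat_cong_mult) (auto simp: mat_cong_sym)
    moreover have "inv\<^bsub>SL_int n\<^esub> Y * Y = 1\<^sub>m n" using l_inv[OF Y(1)] by simp
    ultimately have "Z \<in> congr_Gamma m n"
      using m_closed[OF inv XG] by (simp add: mem_congr_Gamma_iff Z_def)
    moreover have "Y \<in> congr_Gamma l n" using Y by (simp add: mem_congr_Gamma_iff)
    moreover have "X = Y \<otimes>\<^bsub>SL_int n\<^esub> Z"
      unfolding Z_def using Y(1) XG inv by (metis m_assoc r_inv l_one)
    ultimately show "X \<in> congr_Gamma l n <#>\<^bsub>SL_int n\<^esub> congr_Gamma m n"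
      unfolding set_mult_def by blast
  qed
qed

lemma congr_quot_second_iso: "congr_quot n l (lcm l m) \<cong> congr_quot n (gcd l m) m"
proof -
  interpret second_isomorphism_grp "congr_Gamma m n" "SL_int n" "congr_Gamma l n"
    by (simp add: second_isomorphism_grp_def second_isomorphism_grp_axioms_def
        congr_Gamma_normal congr_Gamma_subgroup)
  have "(SL_int n)\<lparr>carrier := congr_Gamma l n\<rparr> Mod (congr_Gamma m n \<inter> congr_Gamma l n)
      \<cong> (SL_int n)\<lparr>carrier := congr_Gamma m n <#>\<^bsub>SL_int n\<^esub> congr_Gamma l n\<rparr> Mod congr_Gamma m n"
    using normal_intersection_quotient_isom unfolding is_iso_def by blast
  then show ?thesis
    by (simp add: congr_quot_def congr_Gamma_Int congr_Gamma_set_mult lcm.commute gcd.commute)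
qed

lemma congr_quot_gcd_lcm_iso_DirProd:
  "congr_quot n (gcd l m) (lcm l m) \<cong> congr_quot n (gcd l m) l \<times>\<times> congr_quot n (gcd l m) m"
proof -
  have "congr_Gamma l n <#>\<^bsub>(SL_int n)\<lparr>carrier := congr_Gamma (gcd l m) n\<rparr>\<^esub> congr_Gamma m n
      = carrier ((SL_int n)\<lparr>carrier := congr_Gamma (gcd l m) n\<rparr>)"
    using congr_Gamma_set_mult[where l = l and m = m and n = n] by (simp add: set_mult_def)
  from normal_quotient_Int_iso_DirProd[OF congr_Gamma_normal_in congr_Gamma_normal_in this]
  show ?thesis by (simp add: congr_quot_def congr_Gamma_Int)
qed

section \<open>Determinants near the identity\<close>

lemma prod_one_plus_cong:
  fixes l :: int
  assumes "finite I"
  shows "[(\<Prod>i\<in>I. 1 + l * a i) = 1 + l * (\<Sum>i\<in>I. a i)] (mod l\<^sup>2)"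
  using assms
proof induction
  case (insert i I)
  have "[(1 + l * a i) * (\<Prod>i\<in>I. 1 + l * a i) = (1 + l * a i) * (1 + l * (\<Sum>i\<in>I. a i))] (mod l\<^sup>2)"
    by (intro cong_mult cong_refl insert.IH)
  also have "(1 + l * a i) * (1 + l * (\<Sum>i\<in>I. a i))
      = 1 + l * (a i + (\<Sum>i\<in>I. a i)) + l\<^sup>2 * (a i * (\<Sum>i\<in>I. a i))"
    by (simp add: algebra_simps power2_eq_square)
  also have "[\<dots> = 1 + l * (a i + (\<Sum>i\<in>I. a i))] (mod l\<^sup>2)"
    by (simp add: cong_iff_dvd_diff)
  finally show ?case using insert by simp
qed simp

text \<open>In the Leibniz formula every permutation other than the identity moves at least two indices,
  an i and its image, and so contributes two off-diagonal factors divisible by l. Only the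
  diagonal product survives modulo \<open>l\<^sup>2\<close>, and its linear term is the trace.\<close>

lemma det_one_plus_smult_cong:
  fixes A :: "int mat"
  assumes A: "A \<in> carrier_mat n n"
  shows "[det (1\<^sub>m n + l \<cdot>\<^sub>m A) = 1 + l * (\<Sum>i<n. A $$ (i, i))] (mod l\<^sup>2)"
proof -
  let ?X = "1\<^sub>m n + l \<cdot>\<^sub>m A" and ?P = "{p. p permutes {0..<n}}"
  define f where "f p = signof p * (\<Prod>i = 0..<n. ?X $$ (i, p i))" for p
  have fin: "finite ?P" by (simp add: finite_permutations)
  have "l\<^sup>2 dvd f p" if p: "p permutes {0..<n}" "p \<noteq> id" for p
  proof -
    obtain i where i: "p i \<noteq> i" using p(2) by (auto simp: fun_eq_iff)
    then have i_n: "i < n" "p i < n" "p (p i) < n" "p (p i) \<noteq> p i"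
      using permutes_in_image[OF p(1)] permutes_not_in[OF p(1), of i] permutes_inj[OF p(1)]
      by (force dest: injD)+
    have "l\<^sup>2 dvd ?X $$ (i, p i) * ?X $$ (p i, p (p i))"
      unfolding power2_eq_square using i i_n A by (intro mult_dvd_mono) auto
    also have "\<dots> = (\<Prod>j\<in>{i, p i}. ?X $$ (j, p j))"
      using i by simp
    also have "\<dots> dvd (\<Prod>j = 0..<n. ?X $$ (j, p j))"
      using i_n by (intro prod_dvd_prod_subset) auto
    finally show ?thesis unfolding f_def by simp
  qed
  then have "[sum f (?P - {id}) = 0] (mod l\<^sup>2)"
    unfolding cong_0_iff by (intro dvd_sum) auto
  moreover have "f id = (\<Prod>i = 0..<n. 1 + l * A $$ (i, i))"
    using A by (auto simp: f_def sign_id intro!: prod.cong)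
  then have "[f id = 1 + l * (\<Sum>i = 0..<n. A $$ (i, i))] (mod l\<^sup>2)"
    using prod_one_plus_cong[of "{0..<n}"] by simp
  ultimately have "[f id + sum f (?P - {id}) = 1 + l * (\<Sum>i = 0..<n. A $$ (i, i)) + 0] (mod l\<^sup>2)"
    by (intro cong_add)
  moreover have "det ?X = f id + sum f (?P - {id})"
    using A sum.remove[OF fin, of id f] det_def'[of ?X n] by (simp add: f_def permutes_id)
  ultimately show ?thesis by (simp add: atLeast0LessThan)
qed

section \<open>The quotient of level l by level m when l divides m and m divides \<open>l\<^sup>2\<close>\<close>

text \<open>The matrix A with \<open>X = 1 + l A\<close>, for X in the congruence subgroup of level l.\<close>

definition first_order_part :: "nat \<Rightarrow> nat \<Rightarrow> int mat \<Rightarrow> int mat" where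
  "first_order_part n l X = mat n n (\<lambda>(i, j). (X $$ (i, j) - 1\<^sub>m n $$ (i, j)) div int l)"

lemma first_order_part_carrier [simp]: "first_order_part n l X \<in> carrier_mat n n"
  by (simp add: first_order_part_def)

lemma first_order_part_eq:
  assumes "X \<in> congr_Gamma l n"
  shows "X = 1\<^sub>m n + int l \<cdot>\<^sub>m first_order_part n l X"
proof (rule eq_matI)
  fix i j assume "i < dim_row (1\<^sub>m n + int l \<cdot>\<^sub>m first_order_part n l X)"
    "j < dim_col (1\<^sub>m n + int l \<cdot>\<^sub>m first_order_part n l X)"
  then have ij: "i < n" "j < n" by (auto simp: first_order_part_def)
  then have "int l dvd X $$ (i, j) - 1\<^sub>m n $$ (i, j)"
    using assms by (auto simp: mem_congr_Gamma_iff mat_cong_def cong_iff_dvd_diff)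
  then show "X $$ (i, j) = (1\<^sub>m n + int l \<cdot>\<^sub>m first_order_part n l X) $$ (i, j)"
    using ij by (auto simp: first_order_part_def)
qed (use assms in \<open>auto simp: mem_congr_Gamma_iff first_order_part_def\<close>)

lemma first_order_part_unique:
  assumes "A \<in> carrier_mat n n" "l \<noteq> 0"
  shows "first_order_part n l (1\<^sub>m n + int l \<cdot>\<^sub>m A) = A"
  using assms by (intro eq_matI) (auto simp: first_order_part_def)

text \<open>\<open>(1 + l A) (1 + l B) = 1 + l (A + B + l A B)\<close>, and the last term vanishes modulo every divisor
  of l: matrix multiplication becomes addition.\<close>

lemma first_order_part_mult:
  assumes X: "X \<in> congr_Gamma l n" and Y: "Y \<in> congr_Gamma l n" and l: "l \<noteq> 0"
    and q: "q dvd int l"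
  shows "mat_cong n q (first_order_part n l (X * Y)) (first_order_part n l X + first_order_part n l Y)"
proof -
  define A B where "A = first_order_part n l X" and "B = first_order_part n l Y"
  have carr: "A \<in> carrier_mat n n" "B \<in> carrier_mat n n" by (simp_all add: A_def B_def)
  have "X * Y = (1\<^sub>m n + int l \<cdot>\<^sub>m A) * (1\<^sub>m n + int l \<cdot>\<^sub>m B)"
    using first_order_part_eq[OF X] first_order_part_eq[OF Y] by (simp add: A_def B_def)
  also have "\<dots> = (1\<^sub>m n + int l \<cdot>\<^sub>m A) + (int l \<cdot>\<^sub>m B + int l \<cdot>\<^sub>m (int l \<cdot>\<^sub>m (A * B)))"
    using carr
    by (simp add: mult_add_distrib_mat[of _ n n _ n] add_mult_distrib_mat[of _ n n _ _ n]
        mult_smult_distrib[of _ n n _ n] mult_smult_assoc_mat[of _ n n _ n]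
        add_smult_distrib_left_mat[of _ n n])
  also have "\<dots> = 1\<^sub>m n + int l \<cdot>\<^sub>m (A + B + int l \<cdot>\<^sub>m (A * B))"
    using carr by (intro eq_matI) (auto simp: algebra_simps)
  finally have "first_order_part n l (X * Y) = A + B + int l \<cdot>\<^sub>m (A * B)"
    using carr l by (simp add: first_order_part_unique)
  then show ?thesis
    using carr q unfolding A_def[symmetric] B_def[symmetric]
    by (auto simp: mat_cong_def cong_iff_dvd_diff)
qed

text \<open>The determinant of X is both 1 and \<open>1 + l tr A\<close> modulo \<open>l\<^sup>2\<close>.\<close>

lemma first_order_part_trace:
  assumes X: "X \<in> congr_Gamma l n" and l: "l \<noteq> 0"
  shows "int l dvd (\<Sum>i<n. first_order_part n l X $$ (i, i))"
proof -
  let ?A = "first_order_part n l X"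
  have "[det (1\<^sub>m n + int l \<cdot>\<^sub>m ?A) = 1 + int l * (\<Sum>i<n. ?A $$ (i, i))] (mod (int l)\<^sup>2)"
    by (rule det_one_plus_smult_cong) simp
  then have "(int l)\<^sup>2 dvd int l * (\<Sum>i<n. ?A $$ (i, i))"
    using X by (simp add: mem_congr_Gamma_iff cong_iff_dvd_diff flip: first_order_part_eq[OF X])
  then show ?thesis using l by (simp add: power2_eq_square)
qed

text \<open>For A of trace zero, \<open>1 + l A\<close> has determinant 1 modulo \<open>l\<^sup>2\<close>, hence modulo \<open>l q\<close>, and a lift
  of it modulo \<open>l q\<close> has first order part A modulo q.\<close>

lemma first_order_part_surj:
  assumes A: "A \<in> carrier_mat n n" and tr: "(\<Sum>i<n. A $$ (i, i)) = 0"
    and l: "l \<noteq> 0" and q: "q dvd l"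
  shows "\<exists>X \<in> congr_Gamma l n. mat_cong n (int q) (first_order_part n l X) A"
proof -
  let ?M = "1\<^sub>m n + int l \<cdot>\<^sub>m A"
  have M: "?M \<in> carrier_mat n n" using A by simp
  have lq: "int l * int q dvd (int l)\<^sup>2"
    using q by (simp add: power2_eq_square)
  have "[det ?M = 1] (mod int l * int q)"
    using cong_dvd_modulus[OF det_one_plus_smult_cong[OF A] lq] tr by simp
  then obtain X where X: "X \<in> carrier_mat n n" "det X = 1" "mat_cong n (int l * int q) X ?M"
    using SL_liftable_if_det_cong_1[OF M] by (auto simp: SL_liftable_def)
  have "mat_cong n (int l) X ?M"
    using X(3) by (rule mat_cong_dvd_modulus) simp
  moreover have "mat_cong n (int l) ?M (1\<^sub>m n)"
    using A by (auto simp: mat_cong_def cong_iff_dvd_diff)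
  ultimately have X\<Gamma>: "X \<in> congr_Gamma l n"
    using X by (auto simp: mem_congr_Gamma_iff intro: mat_cong_trans)
  have "[first_order_part n l X $$ (i, j) = A $$ (i, j)] (mod int q)" if "i < n" "j < n" for i j
  proof -
    let ?a = "first_order_part n l X $$ (i, j)"
    have "X $$ (i, j) = 1\<^sub>m n $$ (i, j) + int l * ?a"
      using that by (subst first_order_part_eq[OF X\<Gamma>]) (auto simp: first_order_part_def)
    then have "int l * int q dvd int l * ?a - int l * A $$ (i, j)"
      using mat_congD[OF X(3) that] A that by (auto simp: cong_iff_dvd_diff)
    then show ?thesis
      using l by (simp add: cong_iff_dvd_diff flip: right_diff_distrib)
  qed
  then show ?thesis using X\<Gamma> by (auto simp: mat_cong_def)
qed

lemma congr_Gamma_iff_first_order_part: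
  assumes X: "X \<in> congr_Gamma l n" and l: "l \<noteq> 0"
  shows "X \<in> congr_Gamma (l * q) n \<longleftrightarrow> mat_cong n (int q) (first_order_part n l X) (0\<^sub>m n n)"
proof -
  have "[X $$ (i, j) = 1\<^sub>m n $$ (i, j)] (mod int (l * q)) \<longleftrightarrow>
      [first_order_part n l X $$ (i, j) = 0] (mod int q)" if "i < n" "j < n" for i j
  proof -
    let ?a = "first_order_part n l X $$ (i, j)"
    have "X $$ (i, j) = 1\<^sub>m n $$ (i, j) + int l * ?a"
      using that by (subst first_order_part_eq[OF X]) (auto simp: first_order_part_def)
    then show ?thesis using l by (simp add: cong_iff_dvd_diff)
  qed
  then show ?thesis using X by (auto simp: mem_congr_Gamma_iff mat_cong_def)
qed

text \<open>Row by row numbering of the positions of an n by n matrix; the number \<open>n\<^sup>2 - 1\<close>, which is left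
  out, belongs to the last diagonal position.\<close>

lemma row_major_index:
  fixes i j n :: nat
  assumes "i < n" "j < n"
  shows "(i * n + j) div n = i" "(i * n + j) mod n = j"
    and "i * n + j < n\<^sup>2 - 1 \<longleftrightarrow> \<not> (i = n - 1 \<and> j = n - 1)"
proof -
  show "(i * n + j) div n = i" "(i * n + j) mod n = j" using assms by auto
  obtain k where n: "n = Suc k" using assms by (cases n) auto
  show "i * n + j < n\<^sup>2 - 1 \<longleftrightarrow> \<not> (i = n - 1 \<and> j = n - 1)"
  proof (cases "i = k")
    case False
    then have "Suc i * n \<le> k * n" using assms n by (intro mult_le_mono1) simp
    then show ?thesis using False assms n by (simp add: power2_eq_square)
  qed (use assms n in \<open>auto simp: power2_eq_square\<close>)
qed

text \<open>The isomorphism lists the entries of the first order part modulo q, except the last diagonal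
  one. That entry carries no information because the trace vanishes modulo q, and the other
  entries can be prescribed because it can be chosen to make the trace zero.\<close>

lemma congr_quot_iso_Zmod_power:
  assumes n: "n \<ge> 1" and l: "l \<noteq> 0" and q: "q \<noteq> 0" "q dvd l"
  shows "congr_quot n l (l * q) \<cong> Zmod_power q (n\<^sup>2 - 1)"
proof -
  define N where "N = n\<^sup>2 - 1"
  let ?G = "(SL_int n)\<lparr>carrier := congr_Gamma l n\<rparr>" and ?H = "Zmod_power q N"
  define \<phi> where "\<phi> X = (\<lambda>k\<in>{..<N}. first_order_part n l X $$ (k div n, k mod n) mod int q)" for X
  have idx: "k div n < n" "k mod n < n" if "k < N" for k
    using that n by (auto simp: N_def power2_eq_square less_mult_imp_div_less)
  have H: "carrier ?H = {..<N} \<rightarrow>\<^sub>E {0..<int q}"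
    "\<And>v w. v \<otimes>\<^bsub>?H\<^esub> w = (\<lambda>k\<in>{..<N}. (v k + w k) mod int q)" "\<one>\<^bsub>?H\<^esub> = (\<lambda>k\<in>{..<N}. 0)"
    using q by (simp_all add: Zmod_power_def carrier_integer_mod_group)
  have "group ?G" by (rule group.subgroup_imp_group[OF group_SL_int congr_Gamma_subgroup])
  moreover have "group ?H" by (simp add: Zmod_power_def)
  moreover have "\<phi> \<in> hom ?G ?H"
  proof (rule homI)
    fix X Y assume "X \<in> carrier ?G" "Y \<in> carrier ?G"
    then have cong: "mat_cong n (int q) (first_order_part n l (X * Y)) (first_order_part n l X + first_order_part n l Y)"
      using first_order_part_mult[OF _ _ l, of X n Y "int q"] q by simp
    have "first_order_part n l (X * Y) $$ (i, j) mod int q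
        = (first_order_part n l X $$ (i, j) mod int q + first_order_part n l Y $$ (i, j) mod int q) mod int q"
      if "i < n" "j < n" for i j
      using mat_congD[OF cong that] that by (simp add: cong_def first_order_part_def mod_add_eq)
    then show "\<phi> (X \<otimes>\<^bsub>?G\<^esub> Y) = \<phi> X \<otimes>\<^bsub>?H\<^esub> \<phi> Y"
      using idx by (simp add: \<phi>_def H cong: restrict_cong)
  next
    show "\<phi> X \<in> carrier ?H" for X
      unfolding H \<phi>_def using q by (simp add: restrict_PiE_iff)
  qed
  ultimately interpret \<phi>: group_hom ?G ?H \<phi>
    by (simp only: group_hom_def group_hom_axioms_def)
  have "\<phi> X = \<one>\<^bsub>?H\<^esub> \<longleftrightarrow> X \<in> congr_Gamma (l * q) n" if X: "X \<in> congr_Gamma l n" for X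
  proof -
    let ?A = "first_order_part n l X"
    have "\<phi> X = \<one>\<^bsub>?H\<^esub> \<longleftrightarrow> (\<forall>k<N. int q dvd ?A $$ (k div n, k mod n))"
      unfolding \<phi>_def H fun_eq_iff restrict_def by (simp add: mod_eq_0_iff_dvd)
    also have "\<dots> \<longleftrightarrow> (\<forall>i<n. \<forall>j<n. int q dvd ?A $$ (i, j))"
    proof (intro iffI allI impI)
      fix i j assume all: "\<forall>k<N. int q dvd ?A $$ (k div n, k mod n)" and ij: "i < n" "j < n"
      \<comment> \<open>The entries in the list vanish, and the trace condition passes this on to the missing one.\<close>
      have off: "int q dvd ?A $$ (i, j)" if "i < n" "j < n" "\<not> (i = n - 1 \<and> j = n - 1)" for i j
        using all row_major_index[OF that(1,2), folded N_def] that(3) by metis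
      have "int q dvd (\<Sum>i<n. ?A $$ (i, i))"
        using first_order_part_trace[OF X l] q by (meson dvd_trans int_dvd_int_iff)
      also have "(\<Sum>i<n. ?A $$ (i, i)) = ?A $$ (n - 1, n - 1) + (\<Sum>i\<in>{..<n} - {n - 1}. ?A $$ (i, i))"
        using n by (intro sum.remove) auto
      finally have "int q dvd ?A $$ (n - 1, n - 1)"
        using off by (subst (asm) dvd_add_left_iff) (auto intro!: dvd_sum)
      then show "int q dvd ?A $$ (i, j)" using off ij by blast
    qed (use idx in auto)
    also have "\<dots> \<longleftrightarrow> X \<in> congr_Gamma (l * q) n"
      by (simp add: congr_Gamma_iff_first_order_part[OF X l] mat_cong_def cong_0_iff)
    finally show ?thesis .
  qed
  moreover have "congr_Gamma (l * q) n \<subseteq> congr_Gamma l n" by (rule congr_Gamma_antimono) simp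
  ultimately have ker: "kernel ?G ?H \<phi> = congr_Gamma (l * q) n"
    by (auto simp: kernel_def)
  have "\<phi> ` carrier ?G = carrier ?H"
  proof
    show "\<phi> ` carrier ?G \<subseteq> carrier ?H" using \<phi>.hom_closed by blast
    show "carrier ?H \<subseteq> \<phi> ` carrier ?G"
    proof
      fix v assume v: "v \<in> carrier ?H"
      define A where "A = mat n n (\<lambda>(i, j). if i = n - 1 \<and> j = n - 1
        then - (\<Sum>i\<in>{..<n} - {n - 1}. v (i * n + i)) else v (i * n + j))"
      have "(\<Sum>i<n. A $$ (i, i)) = A $$ (n - 1, n - 1) + (\<Sum>i\<in>{..<n} - {n - 1}. A $$ (i, i))"
        using n by (intro sum.remove) auto
      also have "\<dots> = 0" using n by (simp add: A_def)
      finally obtain X where X: "X \<in> congr_Gamma l n" "mat_cong n (int q) (first_order_part n l X) A"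
        using first_order_part_surj[of A n l q] l q by (auto simp: A_def)
      have "\<phi> X k = v k" for k
      proof (cases "k < N")
        case True
        have "A $$ (k div n, k mod n) = v k"
          using idx[OF True] row_major_index(3)[OF idx[OF True], folded N_def] True by (auto simp: A_def)
        moreover have "v k mod int q = v k"
          using v True by (auto simp: H PiE_def Pi_def)
        ultimately show ?thesis
          using mat_congD[OF X(2) idx[OF True]] True by (simp add: \<phi>_def cong_def)
      qed (use v in \<open>auto simp: \<phi>_def H PiE_def extensional_def\<close>)
      then show "v \<in> \<phi> ` carrier ?G" using X(1) by (auto intro!: image_eqI[of _ _ X])
    qed
  qed
  from \<phi>.FactGroup_iso[OF this] show ?thesis unfolding ker unfolding congr_quot_def N_def .
qed

section \<open>Quotients between the levels gcd, l, m and lcm\<close>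

theorem theorem1p6:
  fixes l m n :: nat
  assumes "l \<ge> 1" and "m \<ge> 1" and "n \<ge> 3"
  shows "congr_quot n (gcd l m) m \<cong> congr_quot n l (lcm l m)
    \<and> congr_quot n (gcd l m) (lcm l m)
        \<cong> (congr_quot n (gcd l m) l \<times>\<times> congr_quot n (gcd l m) m)
    \<and> congr_quot n (gcd l m) (lcm l m)
        \<cong> (congr_quot n l (lcm l m) \<times>\<times> congr_quot n m (lcm l m))
    \<and> (l dvd m \<and> m dvd l ^ 2 \<longrightarrow> congr_quot n l m \<cong> Zmod_power (m div l) (n ^ 2 - 1))"
proof (intro conjI impI)
  let ?Q = "congr_quot n" and ?g = "gcd l m" and ?L = "lcm l m"
  have l_iso: "?Q ?g m \<cong> ?Q l ?L"
    by (rule group.iso_sym[OF group_congr_quot congr_quot_second_iso]) simp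
  then show "?Q ?g m \<cong> ?Q l ?L" .
  have "?Q ?g l \<cong> ?Q m ?L"
    using group.iso_sym[OF group_congr_quot congr_quot_second_iso, of m l n]
    by (simp add: gcd.commute lcm.commute)
  from group.DirProd_iso_trans[OF group_congr_quot this l_iso]
  have "?Q ?g l \<times>\<times> ?Q ?g m \<cong> ?Q m ?L \<times>\<times> ?Q l ?L" by simp
  also have "?Q m ?L \<times>\<times> ?Q l ?L \<cong> ?Q l ?L \<times>\<times> ?Q m ?L"
    by (rule DirProd_commute_iso)
  finally have "?Q ?g l \<times>\<times> ?Q ?g m \<cong> ?Q l ?L \<times>\<times> ?Q m ?L" .
  then show "?Q ?g ?L \<cong> ?Q l ?L \<times>\<times> ?Q m ?L"
    by (rule iso_trans[OF congr_quot_gcd_lcm_iso_DirProd])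
  show "?Q ?g ?L \<cong> ?Q ?g l \<times>\<times> ?Q ?g m"
    by (rule congr_quot_gcd_lcm_iso_DirProd)
next
  assume dvd: "l dvd m \<and> m dvd l ^ 2"
  then obtain q where q: "m = l * q" by blast
  then have "q dvd l" "q \<noteq> 0" using dvd assms by (auto simp: power2_eq_square)
  then show "congr_quot n l m \<cong> Zmod_power (m div l) (n ^ 2 - 1)"
    using congr_quot_iso_Zmod_power[of n l q] assms q by simp
qed

end
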